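(* Let $(X,\sigma_X)$ and $(Y,\sigma_Y)$ be Deaconu-Renault systems, where $(X,d)$ and $(Y,\rho)$ are metric spaces. Let $\phi:X\to Y$ be a conjugacy between $(X,\sigma_X)$ and $(Y,\sigma_Y)$ such that $\phi$ and $\phi^{-1}$ are uniformly continuous. Then $h_d(\sigma_X)=h_\rho(\sigma_Y)$.
   Context: $\mathbb N=\{1,2,\dots\}$. A Deaconu-Renault system is a pair $(X,\sigma)$ with $X$ a locally compact Hausdorff space and $\sigma:Dom(\sigma)\to Im(\sigma)$ a local homeomorphism from an open set $Dom(\sigma)\subseteq X$ onto an open set $Im(\sigma)\subseteq X$. Put $Dom(\sigma^0)=X$, $\sigma^0=\mathrm{id}$, and inductively $Dom(\sigma^n)=\sigma^{-1}(Dom(\sigma^{n-1}))$, with $\sigma^n$ the $n$-fold composition, defined on $Dom(\sigma^n)$. A conjugacy between $(X,\sigma_X)$ and $(Y,\sigma_Y)$ is a homeomorphism $\phi:X\to Y$ such that $\sigma_Y(\phi(x))=\phi(\sigma_X(x))$ for all $x\in Dom(\sigma_X)$ and $\sigma_X(\phi^{-1}(y))=\phi^{-1}(\sigma_Y(y))$ for all $y\in Dom(\sigma_Y)$ (in particular the left-hand sides are required to be defined; equivalently $\phi(Dom(\sigma_X))=Dom(\sigma_Y)$ and $\phi\circ\sigma_X=\sigma_Y\circ\phi$ on $Dom(\sigma_X)$). Metric entropy of $(X,\sigma)$ on a metric space $(X,d)$ (the metric inducing the topology). For $n\in\mathbb N$, $x\in X$ let $I_n(x)=\{i\in\{0,\dots,n-1\}:x\in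 Dom(\sigma^i)\}$ and $d_n(x,y)=\max_{i\in I_n(x)\cap I_n(y)}d(\sigma^i(x),\sigma^i(y))$. For $K\subseteq X$ compact, $Z\subseteq X$ and $\varepsilon>0$, a set $A\subseteq K\cap Z$ is $(n,\varepsilon,\sigma,K\cap Z)$-separated if $d_n(x,y)>\varepsilon$ for all distinct $x,y\in A$; $sep(n,\varepsilon,\sigma,K\cap Z)$ is the largest cardinality of such a set ($\infty$ if there is no finite bound). Let $ssep(n,\varepsilon,\sigma,K)=\sup_F sep(n,\varepsilon,\sigma,K\cap F)$, the supremum being over all closed subsets $F$ of $X$ with $F\subseteq Dom(\sigma^{n-1})$. Define $h_\varepsilon(\sigma,K,d)=\limsup_{n\to\infty}\frac1n\log ssep(n,\varepsilon,\sigma,K)$ (in the extended reals, $\log\infty=\infty$, and with the convention $\log 0:=0$), $h_d(\sigma,K)=\lim_{\varepsilon\to0}h_\varepsilon(\sigma,K,d)$, and the metric entropy $h_d(\sigma)=\sup_K h_d(\sigma,K)$ over all compact $K\subseteq X$. *)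

theory Defs
  imports "HOL-Analysis.Analysis"
begin

text \<open>
  A partial map on a space is given by a domain \<open>D\<close> together with a total HOL function \<open>\<sigma>\<close>;
  the values of \<open>\<sigma>\<close> outside \<open>D\<close> are irrelevant.
\<close>

definition local_homeomorphism :: "'a topology \<Rightarrow> 'b topology \<Rightarrow> ('a \<Rightarrow> 'b) \<Rightarrow> bool" where
  "local_homeomorphism X Y f \<longleftrightarrow>
     (\<forall>x \<in> topspace X. \<exists>U. openin X U \<and> x \<in> U \<and> openin Y (f ` U) \<and>
        homeomorphic_map (subtopology X U) (subtopology Y (f ` U)) f)"

definition Deaconu_Renault :: "'a topology \<Rightarrow> 'a set \<Rightarrow> ('a \<Rightarrow> 'a) \<Rightarrow> bool" where
  "Deaconu_Renault X D \<sigma> \<longleftrightarrow>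
     locally_compact_space X \<and> Hausdorff_space X \<and>
     openin X D \<and> openin X (\<sigma> ` D) \<and>
     local_homeomorphism (subtopology X D) (subtopology X (\<sigma> ` D)) \<sigma>"

text \<open>
  \<open>iter_dom S D \<sigma> n\<close> is the domain of the \<open>n\<close>-th iterate of the partial map on the point set \<open>S\<close>.
  On it, the iterate is \<open>\<sigma> ^^ n\<close>.
\<close>

primrec iter_dom :: "'a set \<Rightarrow> 'a set \<Rightarrow> ('a \<Rightarrow> 'a) \<Rightarrow> nat \<Rightarrow> 'a set" where
  "iter_dom S D \<sigma> 0 = S"
| "iter_dom S D \<sigma> (Suc n) = {x \<in> D. \<sigma> x \<in> iter_dom S D \<sigma> n}"

definition conjugacy ::
  "'a topology \<Rightarrow> 'a set \<Rightarrow> ('a \<Rightarrow> 'a) \<Rightarrow> 'b topology \<Rightarrow> 'b set \<Rightarrow> ('b \<Rightarrow> 'b) \<Rightarrow> ('a \<Rightarrow> 'b) \<Rightarrow> bool" where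
  "conjugacy X DX \<sigma>X Y DY \<sigma>Y \<phi> \<longleftrightarrow>
     homeomorphic_map X Y \<phi> \<and>
     (\<forall>x \<in> DX. \<phi> x \<in> DY \<and> \<sigma>Y (\<phi> x) = \<phi> (\<sigma>X x)) \<and>
     (\<forall>y \<in> DY. inv_into (topspace X) \<phi> y \<in> DX \<and>
        \<sigma>X (inv_into (topspace X) \<phi> y) = inv_into (topspace X) \<phi> (\<sigma>Y y))"

definition iter_indices :: "'a metric \<Rightarrow> 'a set \<Rightarrow> ('a \<Rightarrow> 'a) \<Rightarrow> nat \<Rightarrow> 'a \<Rightarrow> nat set" where
  "iter_indices m D \<sigma> n x = {i \<in> {..<n}. x \<in> iter_dom (mspace m) D \<sigma> i}"

text \<open>
  For \<open>n \<ge> 1\<close> and points of the space the index set below contains \<open>0\<close>, so the maximum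
  is over a finite nonempty set. The case \<open>n = 0\<close> plays no role: only a limit superior
  as \<open>n\<close> tends to infinity is used.
\<close>

definition iter_dist ::
  "'a metric \<Rightarrow> 'a set \<Rightarrow> ('a \<Rightarrow> 'a) \<Rightarrow> nat \<Rightarrow> 'a \<Rightarrow> 'a \<Rightarrow> real" where
  "iter_dist m D \<sigma> n x y =
     Max ((\<lambda>i. mdist m ((\<sigma> ^^ i) x) ((\<sigma> ^^ i) y)) `
       (iter_indices m D \<sigma> n x \<inter> iter_indices m D \<sigma> n y))"

definition separated_set ::
  "'a metric \<Rightarrow> 'a set \<Rightarrow> ('a \<Rightarrow> 'a) \<Rightarrow> nat \<Rightarrow> real \<Rightarrow> 'a set \<Rightarrow> 'a set \<Rightarrow> bool" where
  "separated_set m D \<sigma> n \<epsilon> W A \<longleftrightarrow>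
     A \<subseteq> W \<and> (\<forall>x \<in> A. \<forall>y \<in> A. x \<noteq> y \<longrightarrow> iter_dist m D \<sigma> n x y > \<epsilon>)"

definition sep ::
  "'a metric \<Rightarrow> 'a set \<Rightarrow> ('a \<Rightarrow> 'a) \<Rightarrow> nat \<Rightarrow> real \<Rightarrow> 'a set \<Rightarrow> enat" where
  "sep m D \<sigma> n \<epsilon> W =
     (SUP A \<in> {A. separated_set m D \<sigma> n \<epsilon> W A}. if finite A then enat (card A) else \<infinity>)"

definition ssep ::
  "'a metric \<Rightarrow> 'a set \<Rightarrow> ('a \<Rightarrow> 'a) \<Rightarrow> nat \<Rightarrow> real \<Rightarrow> 'a set \<Rightarrow> enat" where
  "ssep m D \<sigma> n \<epsilon> K =
     (SUP F \<in> {F. closedin (mtopology_of m) F \<and> F \<subseteq> iter_dom (mspace m) D \<sigma> (n - 1)}.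
        sep m D \<sigma> n \<epsilon> (K \<inter> F))"

text \<open>Extended logarithm with the convention that the logarithm of \<open>0\<close> is \<open>0\<close>.\<close>

definition elog :: "enat \<Rightarrow> ereal" where
  "elog N = (case N of enat k \<Rightarrow> if k = 0 then 0 else ereal (ln (real k)) | \<infinity> \<Rightarrow> \<infinity>)"

definition entropy_eps ::
  "'a metric \<Rightarrow> 'a set \<Rightarrow> ('a \<Rightarrow> 'a) \<Rightarrow> 'a set \<Rightarrow> real \<Rightarrow> ereal" where
  "entropy_eps m D \<sigma> K \<epsilon> = limsup (\<lambda>n. ereal (1 / real n) * elog (ssep m D \<sigma> n \<epsilon> K))"

definition entropy_on ::
  "'a metric \<Rightarrow> 'a set \<Rightarrow> ('a \<Rightarrow> 'a) \<Rightarrow> 'a set \<Rightarrow> ereal" where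
  "entropy_on m D \<sigma> K = Lim (at_right 0) (entropy_eps m D \<sigma> K)"

definition metric_entropy :: "'a metric \<Rightarrow> 'a set \<Rightarrow> ('a \<Rightarrow> 'a) \<Rightarrow> ereal" where
  "metric_entropy m D \<sigma> = (SUP K \<in> {K. compactin (mtopology_of m) K}. entropy_on m D \<sigma> K)"

end

theory Submission
  imports Defs
begin

text \<open>
  Uniform continuity of \<open>\<phi>\<^sup>-\<^sup>1\<close> yields for each \<open>\<epsilon>\<close> some \<open>\<delta>\<close> such that \<open>\<phi>\<close> maps
  \<open>\<epsilon>\<close>-separated sets injectively onto \<open>\<delta>\<close>-separated sets, so the entropy of \<open>\<sigma>\<^sub>X\<close> on \<open>K\<close> is
  at most that of \<open>\<sigma>\<^sub>Y\<close> on \<open>\<phi>(K)\<close>. The same argument for \<open>\<phi>\<^sup>-\<^sup>1\<close> gives the other inequality.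
\<close>

lemma iter_dom_subset: "D \<subseteq> S \<Longrightarrow> iter_dom S D \<sigma> n \<subseteq> S"
  by (cases n) auto

text \<open>Distance hypotheses are available only for points of the space; this lets them be
  applied to the iterates.\<close>

lemma funpow_in_space:
  assumes "\<sigma> ` D \<subseteq> S" "x \<in> iter_dom S D \<sigma> n"
  shows "(\<sigma> ^^ n) x \<in> S"
  using assms(2)
proof (induction n arbitrary: x)
  case (Suc n)
  then show ?case by (simp add: funpow_swap1)
qed simp

text \<open>Induction along the first step of the orbit, as in the recursion for
  \<open>iter_dom\<close>. The intertwining goes in one direction, so it can be used for both a
  conjugacy and its inverse.\<close>

lemma iter_dom_intertwine:
  assumes "\<phi> ` S \<subseteq> T" "\<And>x. x \<in> D \<Longrightarrow> \<phi> x \<in> E \<and> \<tau> (\<phi> x) = \<phi> (\<sigma> x)"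
    and "x \<in> iter_dom S D \<sigma> n"
  shows "\<phi> x \<in> iter_dom T E \<tau> n \<and> (\<tau> ^^ n) (\<phi> x) = \<phi> ((\<sigma> ^^ n) x)"
  using assms(3)
proof (induction n arbitrary: x)
  case 0
  then show ?case using assms(1) by auto
next
  case (Suc n)
  then have "x \<in> D" "\<sigma> x \<in> iter_dom S D \<sigma> n" by auto
  with Suc.IH[of "\<sigma> x"] assms(2)[of x] show ?case
    by (simp add: funpow_swap1)
qed

lemma finite_iter_indices: "finite (iter_indices m D \<sigma> n x)"
  by (simp add: iter_indices_def)

text \<open>Separation becomes the existence of a separating time, which can be transported without
  handling \<open>Max\<close>. Index 0 makes the index set nonempty.\<close>

lemma iter_dist_gt_iff:
  assumes "n > 0" "x \<in> mspace m" "y \<in> mspace m"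
  shows "iter_dist m D \<sigma> n x y > \<epsilon> \<longleftrightarrow>
    (\<exists>i\<in>iter_indices m D \<sigma> n x \<inter> iter_indices m D \<sigma> n y. mdist m ((\<sigma> ^^ i) x) ((\<sigma> ^^ i) y) > \<epsilon>)"
proof -
  have "0 \<in> iter_indices m D \<sigma> n x \<inter> iter_indices m D \<sigma> n y"
    using assms by (simp add: iter_indices_def)
  then show ?thesis
    unfolding iter_dist_def by (subst Max_gr_iff) (auto simp: finite_iter_indices)
qed

text \<open>The convention at 0 respects the order because \<open>ln k\<close> is nonnegative for
  every natural k \<ge> 1.\<close>

lemma elog_mono:
  assumes "M \<le> N"
  shows "elog M \<le> elog N"
  using assms by (cases M; cases N) (auto simp: elog_def)

text \<open>Lowering the threshold only enlarges the family of separated sets. This gives the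
  monotonicity in \<epsilon> behind \<open>entropy_on_eq_SUP\<close>.\<close>

lemma ssep_antimono:
  assumes "\<delta> \<le> \<epsilon>"
  shows "ssep m D \<sigma> n \<epsilon> K \<le> ssep m D \<sigma> n \<delta> K"
proof -
  have "separated_set m D \<sigma> n \<delta> W A" if "separated_set m D \<sigma> n \<epsilon> W A" for W A
    using that assms unfolding separated_set_def by (meson order_le_less_trans)
  then have "sep m D \<sigma> n \<epsilon> W \<le> sep m D \<sigma> n \<delta> W" for W
    unfolding sep_def by (intro SUP_subset_mono) auto
  then show ?thesis
    unfolding ssep_def by (intro SUP_mono) blast
qed

text \<open>The comparison is asked for n > 0 only, since at n = 0 the \<open>Max\<close> in
  \<open>iter_dist\<close> runs over the empty set; a limsup ignores that index.\<close>

lemma entropy_eps_mono: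
  assumes "\<And>n. n > 0 \<Longrightarrow> ssep m D \<sigma> n \<epsilon> K \<le> ssep m' D' \<sigma>' n \<epsilon>' K'"
  shows "entropy_eps m D \<sigma> K \<epsilon> \<le> entropy_eps m' D' \<sigma>' K' \<epsilon>'"
  unfolding entropy_eps_def
proof (rule Limsup_mono)
  show "\<forall>\<^sub>F n in sequentially. ereal (1 / real n) * elog (ssep m D \<sigma> n \<epsilon> K)
      \<le> ereal (1 / real n) * elog (ssep m' D' \<sigma>' n \<epsilon>' K')"
    using eventually_gt_at_top[of 0]
    by eventually_elim (intro ereal_mult_left_mono elog_mono assms, auto)
qed

text \<open>An antitone function rises to its supremum as the argument decreases to a. If c lies
  below the supremum, some value f t exceeds c, and then so do all values on (a, t).\<close>

lemma Lim_at_right_eq_SUP: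
  fixes f :: "real \<Rightarrow> ereal"
  assumes "\<And>s t. a < s \<Longrightarrow> s \<le> t \<Longrightarrow> f t \<le> f s"
  shows "Lim (at_right a) f = (SUP t\<in>{a<..}. f t)"
proof (rule tendsto_Lim)
  show "(f \<longlongrightarrow> (SUP t\<in>{a<..}. f t)) (at_right a)"
  proof (rule order_tendstoI)
    fix c assume "c < (SUP t\<in>{a<..}. f t)"
    then obtain t where t: "a < t" "c < f t"
      by (auto simp: less_SUP_iff)
    then have "c < f s" if "a < s" "s < t" for s
      using assms[of s t] that by (auto intro: less_le_trans)
    then show "\<forall>\<^sub>F s in at_right a. c < f s"
      using t(1) by (auto simp: eventually_at_right)
  next
    fix c assume c: "(SUP t\<in>{a<..}. f t) < c"
    show "\<forall>\<^sub>F s in at_right a. f s < c"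
      using eventually_at_right_less
      by eventually_elim (intro le_less_trans[OF SUP_upper c], simp)
  qed
qed simp

text \<open>With a supremum in place of the limit, two entropies are compared by finding for each
  \<epsilon> just one suitable scale on the other side.\<close>

lemma entropy_on_eq_SUP: "entropy_on m D \<sigma> K = (SUP \<epsilon>\<in>{0<..}. entropy_eps m D \<sigma> K \<epsilon>)"
  unfolding entropy_on_def
  by (intro Lim_at_right_eq_SUP entropy_eps_mono ssep_antimono)

text \<open>A time i that separates x and y also separates their images: the i-th iterates of the
  images are the images of the i-th iterates, to which \<open>unif\<close> applies.\<close>

lemma separated_set_image:
  assumes D: "D \<subseteq> mspace m" "\<sigma> ` D \<subseteq> mspace m"
    and maps: "\<phi> ` mspace m \<subseteq> mspace m'"
    and inter: "\<And>x. x \<in> D \<Longrightarrow> \<phi> x \<in> D' \<and> \<sigma>' (\<phi> x) = \<phi> (\<sigma> x)"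
    and unif: "\<And>x y. x \<in> mspace m \<Longrightarrow> y \<in> mspace m \<Longrightarrow> mdist m x y > \<epsilon> \<Longrightarrow> mdist m' (\<phi> x) (\<phi> y) > \<delta>"
    and "n > 0" "W \<subseteq> mspace m" and A: "separated_set m D \<sigma> n \<epsilon> W A"
  shows "separated_set m' D' \<sigma>' n \<delta> (\<phi> ` W) (\<phi> ` A)"
  unfolding separated_set_def
proof (intro conjI ballI impI)
  have "A \<subseteq> W" using A by (simp add: separated_set_def)
  then show "\<phi> ` A \<subseteq> \<phi> ` W" by auto
  fix u v assume "u \<in> \<phi> ` A" "v \<in> \<phi> ` A" "u \<noteq> v"
  then obtain x y where xy: "u = \<phi> x" "v = \<phi> y" "x \<in> A" "y \<in> A" "x \<noteq> y" by auto
  then have sp: "x \<in> mspace m" "y \<in> mspace m" using \<open>A \<subseteq> W\<close> \<open>W \<subseteq> mspace m\<close> by auto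
  have "iter_dist m D \<sigma> n x y > \<epsilon>" using A xy by (auto simp: separated_set_def)
  then obtain i where i: "i < n" "x \<in> iter_dom (mspace m) D \<sigma> i" "y \<in> iter_dom (mspace m) D \<sigma> i"
      "mdist m ((\<sigma> ^^ i) x) ((\<sigma> ^^ i) y) > \<epsilon>"
    using iter_dist_gt_iff[OF \<open>n > 0\<close> sp] by (auto simp: iter_indices_def)
  note ix = iter_dom_intertwine[of \<phi> _ _ D D' \<sigma>' \<sigma>, OF maps inter i(2)]
    and iy = iter_dom_intertwine[of \<phi> _ _ D D' \<sigma>' \<sigma>, OF maps inter i(3)]
  have "mdist m' ((\<sigma>' ^^ i) u) ((\<sigma>' ^^ i) v) > \<delta>"
    using unif[OF funpow_in_space[OF D(2) i(2)] funpow_in_space[OF D(2) i(3)] i(4)] ix iy xy by simp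
  moreover have "i \<in> iter_indices m' D' \<sigma>' n u \<inter> iter_indices m' D' \<sigma>' n v"
    using i(1) ix iy xy by (simp add: iter_indices_def)
  moreover have "u \<in> mspace m'" "v \<in> mspace m'" using sp xy maps by auto
  note iter_dist_gt_iff[OF \<open>n > 0\<close> this]
  ultimately show "iter_dist m' D' \<sigma>' n u v > \<delta>"
    by blast
qed

text \<open>Every competitor in the two nested suprema has a counterpart: F goes to the closed set
  \<open>\<phi>\<close> F\<open>inside the matching iterate domain, and A to\<close>\<phi>
  \<open>A\<close>, with the same cardinality by injectivity.\<close>

lemma ssep_le_image:
  assumes D: "D \<subseteq> mspace m" "\<sigma> ` D \<subseteq> mspace m"
    and hom: "homeomorphic_map (mtopology_of m) (mtopology_of m') \<phi>"
    and inter: "\<And>x. x \<in> D \<Longrightarrow> \<phi> x \<in> D' \<and> \<sigma>' (\<phi> x) = \<phi> (\<sigma> x)"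
    and unif: "\<And>x y. x \<in> mspace m \<Longrightarrow> y \<in> mspace m \<Longrightarrow> mdist m x y > \<epsilon> \<Longrightarrow> mdist m' (\<phi> x) (\<phi> y) > \<delta>"
    and n: "n > 0" and K: "K \<subseteq> mspace m"
  shows "ssep m D \<sigma> n \<epsilon> K \<le> ssep m' D' \<sigma>' n \<delta> (\<phi> ` K)"
  unfolding ssep_def
proof (rule SUP_mono)
  fix F assume "F \<in> {F. closedin (mtopology_of m) F \<and> F \<subseteq> iter_dom (mspace m) D \<sigma> (n - 1)}"
  then have F: "closedin (mtopology_of m) F" "F \<subseteq> iter_dom (mspace m) D \<sigma> (n - 1)" by auto
  have maps: "\<phi> ` mspace m \<subseteq> mspace m'" and inj: "inj_on \<phi> (mspace m)"
    using homeomorphic_imp_surjective_map[OF hom] homeomorphic_imp_injective_map[OF hom] by auto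
  have Fm: "F \<subseteq> mspace m"
    using F(2) iter_dom_subset[OF D(1)] by blast
  have "closedin (mtopology_of m') (\<phi> ` F)"
    using hom F(1) Fm by (simp add: homeomorphic_map_closedness)
  moreover have "\<phi> ` F \<subseteq> iter_dom (mspace m') D' \<sigma>' (n - 1)"
    using iter_dom_intertwine[of \<phi> _ _ D D' \<sigma>' \<sigma>, OF maps inter] F(2) by blast
  moreover have "sep m D \<sigma> n \<epsilon> (K \<inter> F) \<le> sep m' D' \<sigma>' n \<delta> (\<phi> ` K \<inter> \<phi> ` F)"
    unfolding sep_def
  proof (rule SUP_mono)
    fix A assume "A \<in> {A. separated_set m D \<sigma> n \<epsilon> (K \<inter> F) A}"
    then have A: "separated_set m D \<sigma> n \<epsilon> (K \<inter> F) A" by simp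
    have "A \<subseteq> mspace m" using A K by (auto simp: separated_set_def)
    then have injA: "inj_on \<phi> A" using inj inj_on_subset by blast
    have "separated_set m' D' \<sigma>' n \<delta> (\<phi> ` (K \<inter> F)) (\<phi> ` A)"
      using K by (intro separated_set_image[OF D maps inter unif n _ A]) auto
    \<comment> \<open>Injectivity turns the image of the intersection into the form K' \<inter> G
      that occurs in \<open>ssep\<close>, with K' the image of K and G that of F.\<close>
    moreover have "\<phi> ` (K \<inter> F) = \<phi> ` K \<inter> \<phi> ` F"
      using inj_on_image_Int[OF inj K Fm] .
    ultimately show "\<exists>B\<in>{B. separated_set m' D' \<sigma>' n \<delta> (\<phi> ` K \<inter> \<phi> ` F) B}.
        (if finite A then enat (card A) else \<infinity>) \<le> (if finite B then enat (card B) else \<infinity>)"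
      by (intro bexI[of _ "\<phi> ` A"]) (auto simp: card_image[OF injA] finite_image_iff[OF injA])
  qed
  ultimately show "\<exists>G\<in>{G. closedin (mtopology_of m') G \<and> G \<subseteq> iter_dom (mspace m') D' \<sigma>' (n - 1)}.
      sep m D \<sigma> n \<epsilon> (K \<inter> F) \<le> sep m' D' \<sigma>' n \<delta> (\<phi> ` K \<inter> G)"
    by blast
qed

text \<open>One half of the theorem. The left inverse \<psi> is a free parameter, so that in the
  reverse application \<phi> itself can take this place.\<close>

lemma metric_entropy_le:
  assumes D: "D \<subseteq> mspace m" "\<sigma> ` D \<subseteq> mspace m"
    and hom: "homeomorphic_map (mtopology_of m) (mtopology_of m') \<phi>"
    and inter: "\<And>x. x \<in> D \<Longrightarrow> \<phi> x \<in> D' \<and> \<sigma>' (\<phi> x) = \<phi> (\<sigma> x)"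
    and unif: "uniformly_continuous_map m' m \<psi>"
    and inv: "\<And>x. x \<in> mspace m \<Longrightarrow> \<psi> (\<phi> x) = x"
  shows "metric_entropy m D \<sigma> \<le> metric_entropy m' D' \<sigma>'"
  unfolding metric_entropy_def
proof (rule SUP_mono)
  fix K assume "K \<in> {K. compactin (mtopology_of m) K}"
  then have K: "compactin (mtopology_of m) K" by simp
  then have Km: "K \<subseteq> mspace m" using compactin_subset_topspace by force
  have maps: "\<phi> ` mspace m \<subseteq> mspace m'"
    using homeomorphic_imp_surjective_map[OF hom] by auto
  have "compactin (mtopology_of m') (\<phi> ` K)"
    using K Km hom by (simp add: homeomorphic_map_compactness)
  moreover have "entropy_on m D \<sigma> K \<le> entropy_on m' D' \<sigma>' (\<phi> ` K)"
    unfolding entropy_on_eq_SUP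
  proof (rule SUP_mono)
    fix \<epsilon> :: real assume "\<epsilon> \<in> {0<..}"
    then obtain \<delta> where \<delta>: "\<delta> > 0"
      "\<And>u v. u \<in> mspace m' \<Longrightarrow> v \<in> mspace m' \<Longrightarrow> mdist m' v u < \<delta> \<Longrightarrow> mdist m (\<psi> v) (\<psi> u) < \<epsilon>"
      using unif unfolding uniformly_continuous_map_def by (metis greaterThan_iff)
    \<comment> \<open>The contrapositive of uniform continuity of \<psi> gives only distance \<ge>
      \<delta>; halving \<delta> restores the strict inequality demanded of separated sets.\<close>
    have far: "mdist m' (\<phi> x) (\<phi> y) > \<delta> / 2"
      if "x \<in> mspace m" "y \<in> mspace m" "mdist m x y > \<epsilon>" for x y
      using \<delta>(1) \<delta>(2)[of "\<phi> y" "\<phi> x"] that maps inv by fastforce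
    have "entropy_eps m D \<sigma> K \<epsilon> \<le> entropy_eps m' D' \<sigma>' (\<phi> ` K) (\<delta> / 2)"
      by (rule entropy_eps_mono, rule ssep_le_image[OF D hom inter far _ Km])
    then show "\<exists>\<delta>\<in>{0<..}. entropy_eps m D \<sigma> K \<epsilon> \<le> entropy_eps m' D' \<sigma>' (\<phi> ` K) \<delta>"
      using \<delta>(1) by (intro bexI[of _ "\<delta> / 2"]) auto
  qed
  ultimately show "\<exists>L\<in>{L. compactin (mtopology_of m') L}.
      entropy_on m D \<sigma> K \<le> entropy_on m' D' \<sigma>' L"
    by blast
qed

lemma Deaconu_Renault_subset:
  assumes "Deaconu_Renault (mtopology_of m) D \<sigma>"
  shows "D \<subseteq> mspace m" "\<sigma> ` D \<subseteq> mspace m"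
  using assms openin_subset[of "mtopology_of m"] by (auto simp: Deaconu_Renault_def)

theorem theorem3p24:
  fixes mX :: "'a metric" and mY :: "'b metric"
    and DX :: "'a set" and \<sigma>X :: "'a \<Rightarrow> 'a"
    and DY :: "'b set" and \<sigma>Y :: "'b \<Rightarrow> 'b"
    and \<phi> :: "'a \<Rightarrow> 'b"
  assumes "Deaconu_Renault (mtopology_of mX) DX \<sigma>X"
    and "Deaconu_Renault (mtopology_of mY) DY \<sigma>Y"
    and "conjugacy (mtopology_of mX) DX \<sigma>X (mtopology_of mY) DY \<sigma>Y \<phi>"
    and "uniformly_continuous_map mX mY \<phi>"
    and "uniformly_continuous_map mY mX (inv_into (mspace mX) \<phi>)"
  shows "metric_entropy mX DX \<sigma>X = metric_entropy mY DY \<sigma>Y"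
proof (rule antisym)
  let ?\<psi> = "inv_into (mspace mX) \<phi>"
  have hom: "homeomorphic_map (mtopology_of mX) (mtopology_of mY) \<phi>"
    and fwd: "\<And>x. x \<in> DX \<Longrightarrow> \<phi> x \<in> DY \<and> \<sigma>Y (\<phi> x) = \<phi> (\<sigma>X x)"
    and bwd: "\<And>y. y \<in> DY \<Longrightarrow> ?\<psi> y \<in> DX \<and> \<sigma>X (?\<psi> y) = ?\<psi> (\<sigma>Y y)"
    using assms(3) by (auto simp: conjugacy_def)
  have surj: "\<phi> ` mspace mX = mspace mY" and inj: "inj_on \<phi> (mspace mX)"
    using homeomorphic_imp_surjective_map[OF hom] homeomorphic_imp_injective_map[OF hom] by auto
  show "metric_entropy mX DX \<sigma>X \<le> metric_entropy mY DY \<sigma>Y"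
    using metric_entropy_le[OF Deaconu_Renault_subset[OF assms(1)] hom fwd assms(5)] inj
    by simp
  \<comment> \<open>The reverse inequality needs \<open>?\<psi>\<close> as a homeomorphism. The
    topological inverse g agrees with it on the whole space of \<open>mY\<close>, so the property
    carries over.\<close>
  obtain g where g: "homeomorphic_maps (mtopology_of mX) (mtopology_of mY) \<phi> g"
    using hom homeomorphic_map_maps by blast
  then have "homeomorphic_map (mtopology_of mY) (mtopology_of mX) g"
    using homeomorphic_maps_map by blast
  moreover have "g y = ?\<psi> y" if "y \<in> topspace (mtopology_of mY)" for y
  proof -
    from that have "y \<in> \<phi> ` mspace mX" by (simp add: surj)
    then obtain x where "x \<in> mspace mX" "y = \<phi> x" by blast
    then show ?thesis using g inj by (simp add: homeomorphic_maps_def)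
  qed
  ultimately have "homeomorphic_map (mtopology_of mY) (mtopology_of mX) ?\<psi>"
    by (rule homeomorphic_map_eq)
  \<comment> \<open>Roles are exchanged: by surjectivity \<phi> is a left inverse of
    \<open>?\<psi>\<close> on \<open>mspace mY\<close>, and now its uniform continuity is
    used.\<close>
  from metric_entropy_le[OF Deaconu_Renault_subset[OF assms(2)] this bwd assms(4)] surj
  show "metric_entropy mY DY \<sigma>Y \<le> metric_entropy mX DX \<sigma>X"
    by (simp add: f_inv_into_f)
qed

end
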